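(* Let $M_G$ be a mixed graph whose underlying graph $G$ is simple, finite and connected. Then $M_G$ has property $SP$ if and only if every mixed cycle of $M_G$ belongs to $\Phi_4$.
   Context: A mixed graph $M_G$ is obtained from $G$ by giving directions to some of its edges. $M_G$ has property $SP$ if its vertex set can be partitioned into six (possibly empty) parts $V_1,\dots,V_6$ such that every undirected edge has both endpoints in the same part, and every directed edge goes from a vertex of $V_i$ to a vertex of $V_{i+1}$ for some $i\in\{1,\dots,5\}$, or from a vertex of $V_6$ to a vertex of $V_1$. A mixed cycle of $M_G$ is the mixed subgraph on a cycle of $G$. For a mixed cycle, fix one of its two cyclic traversal directions and let $a$ (resp. $b$) be the number of directed edges oriented along (resp. against) the traversal; the cycle belongs to $\Phi_4$ if $a-b\equiv 0\pmod 6$. *)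

theory Defs
  imports "Graph_Theory.Graph_Theory" "HOL-Library.Disjoint_Sets" "HOL-Number_Theory.Cong"
begin

text \<open>
  A graph is a symmetric digraph \<open>G\<close>, so an edge \<open>uv\<close> is the pair of arcs \<open>(u,v)\<close>, \<open>(v,u)\<close>.
  A mixed graph on \<open>G\<close> is given by the set \<open>D\<close> of its directed edges: \<open>(u,v) \<in> D\<close> says that
  the edge \<open>uv\<close> is directed from \<open>u\<close> to \<open>v\<close>.
\<close>

definition mixed_graph :: "'a pair_pre_digraph \<Rightarrow> 'a rel \<Rightarrow> bool" where
  "mixed_graph G D \<longleftrightarrow> D \<subseteq> parcs G \<and> (\<forall>u v. (u, v) \<in> D \<longrightarrow> (v, u) \<notin> D)"

definition undirected_edge :: "'a pair_pre_digraph \<Rightarrow> 'a rel \<Rightarrow> 'a \<Rightarrow> 'a \<Rightarrow> bool" where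
  "undirected_edge G D u v \<longleftrightarrow> (u, v) \<in> parcs G \<and> (u, v) \<notin> D \<and> (v, u) \<notin> D"

definition property_SP :: "'a pair_pre_digraph \<Rightarrow> 'a rel \<Rightarrow> bool" where
  "property_SP G D \<longleftrightarrow>
    (\<exists>V :: nat \<Rightarrow> 'a set.
      (\<Union>i\<in>{1..6}. V i) = pverts G \<and> disjoint_family_on V {1..6} \<and>
      (\<forall>u v. undirected_edge G D u v \<longrightarrow> (\<exists>i\<in>{1..6}. u \<in> V i \<and> v \<in> V i)) \<and>
      (\<forall>u v. (u, v) \<in> D \<longrightarrow>
        (\<exists>i\<in>{1..5}. u \<in> V i \<and> v \<in> V (i + 1)) \<or> (u \<in> V 6 \<and> v \<in> V 1)))"

text \<open>
  A cycle is represented by its traversals, i.e. closed arc walks. The length condition excludes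
  the walk \<open>u, v, u\<close> along a single edge, which is a cycle of the symmetric digraph but not of
  the graph.
\<close>

definition cycle_traversal :: "'a pair_pre_digraph \<Rightarrow> ('a \<times> 'a) awalk \<Rightarrow> bool" where
  "cycle_traversal G p \<longleftrightarrow> pre_digraph.cycle (with_proj G) p \<and> 3 \<le> length p"

definition num_along :: "'a rel \<Rightarrow> ('a \<times> 'a) awalk \<Rightarrow> nat" where
  "num_along D p = length (filter (\<lambda>(u, v). (u, v) \<in> D) p)"

definition num_against :: "'a rel \<Rightarrow> ('a \<times> 'a) awalk \<Rightarrow> nat" where
  "num_against D p = length (filter (\<lambda>(u, v). (v, u) \<in> D) p)"

definition in_Phi4 :: "'a rel \<Rightarrow> ('a \<times> 'a) awalk \<Rightarrow> bool" where
  "in_Phi4 D p \<longleftrightarrow> [int (num_along D p) - int (num_against D p) = 0] (mod 6)"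

text \<open>
  Membership in \<open>\<Phi>\<^sub>4\<close> depends neither on the direction of traversal nor on the starting point,
  so it is a property of the mixed cycle.
\<close>

lemma num_along_rev_path: "num_along D (rev_path p) = num_against D p"
  by (induction p) (auto simp: num_along_def num_against_def)

lemma num_against_rev_path: "num_against D (rev_path p) = num_along D p"
  by (induction p) (auto simp: num_along_def num_against_def)

lemma in_Phi4_rev_path: "in_Phi4 D (rev_path p) \<longleftrightarrow> in_Phi4 D p"
  unfolding in_Phi4_def num_along_rev_path num_against_rev_path
  by (simp add: cong_0_iff dvd_diff_commute)

lemma in_Phi4_rotate: "in_Phi4 D (q @ p) \<longleftrightarrow> in_Phi4 D (p @ q)"
  by (simp add: in_Phi4_def num_along_def num_against_def add.commute)

end

theory Submission
  imports Defs
begin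

text \<open>
  Give a directed edge the gain \<open>1\<close> along and \<open>-1\<close> against its direction, and an undirected edge
  the gain \<open>0\<close>. A partition as in property \<open>SP\<close> is the same thing as a potential modulo 6 whose
  differences along arcs are the gains. If a potential exists, then gains telescope around every
  cycle. Conversely, every closed walk splits into cycles and back-and-forth traversals of single
  edges, so all closed walks have gain \<open>0\<close> modulo 6, and the gain of a walk from a fixed root
  depends only on its end vertex modulo 6: it is a potential.
\<close>

text \<open>An arc gets its gain as a walk of length one, so additivity under \<open>@\<close>
  reduces every gain to those of single arcs.\<close>

definition gain :: "'a rel \<Rightarrow> ('a \<times> 'a) awalk \<Rightarrow> int" where
  "gain D p = int (num_along D p) - int (num_against D p)"

lemma gain_Nil [simp]: "gain D [] = 0"
  by (simp add: gain_def num_along_def num_against_def)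

lemma gain_append [simp]: "gain D (p @ q) = gain D p + gain D q"
  by (simp add: gain_def num_along_def num_against_def)

lemma gain_Cons: "gain D (e # p) = gain D [e] + gain D p"
  using gain_append[of D "[e]" p] by simp

lemma gain_rev_path [simp]: "gain D (rev_path p) = - gain D p"
  by (simp add: gain_def num_along_rev_path num_against_rev_path)

lemma gain_swap: "gain D [(v, u)] = - gain D [(u, v)]"
  by (simp add: gain_def num_along_def num_against_def)

lemma in_Phi4_iff_gain: "in_Phi4 D p \<longleftrightarrow> [gain D p = 0] (mod 6)"
  by (simp add: in_Phi4_def gain_def)

lemma gain_undirected:
  "(u, v) \<notin> D \<Longrightarrow> (v, u) \<notin> D \<Longrightarrow> gain D [(u, v)] = 0"
  by (simp add: gain_def num_along_def num_against_def)

lemma gain_directed: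
  "mixed_graph G D \<Longrightarrow> (u, v) \<in> D \<Longrightarrow> gain D [(u, v)] = 1"
  by (auto simp: gain_def num_along_def num_against_def mixed_graph_def)

text \<open>A potential with values in the integers modulo \<open>m\<close>, represented by
  arbitrary integers. Only the translation into six parts depends on \<open>m\<close> being
  6.\<close>

definition potential :: "int \<Rightarrow> 'a pair_pre_digraph \<Rightarrow> 'a rel \<Rightarrow> ('a \<Rightarrow> int) \<Rightarrow> bool" where
  "potential m G D f \<longleftrightarrow>
    (\<forall>u v. (u, v) \<in> parcs G \<longrightarrow> [f v = f u + gain D [(u, v)]] (mod m))"

text \<open>The differences of \<open>f\<close> along consecutive arcs telescope.\<close>

lemma potential_walk:
  assumes "potential m G D f" "set p \<subseteq> parcs G" "pcas u p v"
  shows "[f v = f u + gain D p] (mod m)"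
  using assms(2,3)
proof (induction p arbitrary: u)
  case (Cons e p)
  obtain w where e: "e = (u, w)" using Cons.prems by (cases e) auto
  have "[f v = f w + gain D p] (mod m)"
    using Cons e by auto
  moreover have "[f w = f u + gain D [e]] (mod m)"
    using assms(1) Cons.prems e by (auto simp: potential_def)
  ultimately have "[f v = (f u + gain D [e]) + gain D p] (mod m)"
    using cong_trans cong_add cong_refl by blast
  then show ?case
    by (simp add: gain_Cons[of D e p] add.assoc)
qed simp

lemma SP_imp_potential:
  assumes "mixed_graph G D" "property_SP G D"
  shows "\<exists>f. potential 6 G D f"
proof -
  obtain V :: "nat \<Rightarrow> 'a set" where
    disj: "disjoint_family_on V {1..6}"
    and und: "\<And>u v. undirected_edge G D u v \<Longrightarrow> \<exists>i\<in>{1..6}. u \<in> V i \<and> v \<in> V i"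
    and dir: "\<And>u v. (u, v) \<in> D \<Longrightarrow>
      (\<exists>i\<in>{1..5}. u \<in> V i \<and> v \<in> V (i + 1)) \<or> (u \<in> V 6 \<and> v \<in> V 1)"
    using assms(2) unfolding property_SP_def by blast
  \<comment> \<open>The index of the part containing \<open>v\<close>. Disjointness makes it unique,
    and the edge conditions put both ends of every arc into some part.\<close>
  define f where "f v = int (THE i. i \<in> {1..6} \<and> v \<in> V i)" for v
  have f: "f v = int i" if "i \<in> {1..6}" "v \<in> V i" for v i
  proof -
    have "(THE i. i \<in> {1..6} \<and> v \<in> V i) = i"
      using that disjoint_family_onD[OF disj] by (intro the_equality) blast+
    then show ?thesis by (simp add: f_def)
  qed
  have directed: "[f v = f u + 1] (mod 6)" if "(u, v) \<in> D" for u v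
    using dir[OF that]
  proof (elim disjE bexE conjE)
    fix i :: nat assume "i \<in> {1..5}" "u \<in> V i" "v \<in> V (i + 1)"
    then show ?thesis using f[of i u] f[of "i + 1" v] by (simp add: add.commute)
  next
    \<comment> \<open>The wrap-around from the last part to the first is harmless because 1 and 6 +
      1 agree modulo 6.\<close>
    assume "u \<in> V 6" "v \<in> V 1"
    then show ?thesis using f[of 6 u] f[of 1 v] by (simp add: cong_def)
  qed
  have "[f v = f u + gain D [(u, v)]] (mod 6)" if uv: "(u, v) \<in> parcs G" for u v
  proof -
    consider "(u, v) \<in> D" | "(v, u) \<in> D" | "undirected_edge G D u v"
      using uv by (auto simp: undirected_edge_def)
    then show ?thesis
    proof cases
      case 1
      then show ?thesis using directed gain_directed[OF assms(1)] by simp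
    next
      case 2
      then have "gain D [(u, v)] = -1"
        using gain_directed[OF assms(1) 2] gain_swap[of D u v] by simp
      then show ?thesis
        using cong_add[OF directed[OF 2] cong_refl[of "-1"]] by (simp add: cong_sym)
    next
      case 3
      then obtain i where "i \<in> {1..6}" "u \<in> V i" "v \<in> V i" using und by blast
      then have "f u = f v" using f by simp
      then show ?thesis using 3 by (simp add: undirected_edge_def gain_undirected)
    qed
  qed
  then show ?thesis by (auto simp: potential_def)
qed

lemma potential_imp_SP:
  assumes "pair_graph G" "mixed_graph G D" "potential 6 G D f"
  shows "property_SP G D"
proof -
  interpret pair_graph G by fact
  \<comment> \<open>The parts are the residue classes of \<open>f\<close>; the shift by 1 turns
    residues 0 to 5 into indices 1 to 6.\<close>
  define part where "part v = nat (f v mod 6) + 1" for v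
  define V where "V i = {v \<in> pverts G. part v = i}" for i
  have part_range: "part v \<in> {1..6}" for v
    unfolding part_def using pos_mod_bound[of 6 "f v"] by auto
  have undirected: "part u = part v" if "undirected_edge G D u v" for u v
    using assms(3) that
    by (auto simp: potential_def undirected_edge_def gain_undirected part_def cong_def)
  have directed: "part u \<in> {1..5} \<and> part v = part u + 1 \<or> part u = 6 \<and> part v = 1"
    if "(u, v) \<in> D" for u v
  proof -
    have "(u, v) \<in> parcs G" using assms(2) that by (auto simp: mixed_graph_def)
    then have "f v mod 6 = (f u + 1) mod 6"
      using assms(3) that by (simp add: potential_def gain_directed[OF assms(2)] cong_def)
    then have step: "f v mod 6 = (f u mod 6 + 1) mod 6" by (simp add: mod_simps)
    \<comment> \<open>Residue 5 is the only one with a wrap-around; after the shift this is the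
      passage from part 6 to part 1.\<close>
    have "f v mod 6 = f u mod 6 + 1 \<and> f u mod 6 < 5 \<or> f v mod 6 = 0 \<and> f u mod 6 = 5"
    proof (cases "f u mod 6 = 5")
      case False
      then have "f u mod 6 < 5" using pos_mod_bound[of 6 "f u"] by linarith
      then show ?thesis using step by (simp add: mod_pos_pos_trivial)
    qed (use step in simp)
    moreover have "f u mod 6 \<ge> 0" by simp
    ultimately show ?thesis unfolding part_def by (elim disjE) auto
  qed
  have "(\<Union>i\<in>{1..6}. V i) = pverts G"
    using part_range by (auto simp: V_def)
  moreover have "disjoint_family_on V {1..6}"
    by (auto simp: disjoint_family_on_def V_def)
  moreover have "\<exists>i\<in>{1..6}. u \<in> V i \<and> v \<in> V i" if "undirected_edge G D u v" for u v
    using undirected[OF that] that part_range[of v]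
    by (auto simp: V_def undirected_edge_def dest: in_arcsD1 in_arcsD2)
  moreover have "(\<exists>i\<in>{1..5}. u \<in> V i \<and> v \<in> V (i + 1)) \<or> (u \<in> V 6 \<and> v \<in> V 1)"
    if "(u, v) \<in> D" for u v
  proof -
    have "(u, v) \<in> parcs G" using assms(2) that by (auto simp: mixed_graph_def)
    then show ?thesis
      using directed[OF that] by (auto simp: V_def dest: in_arcsD1 in_arcsD2)
  qed
  ultimately show ?thesis unfolding property_SP_def by blast
qed

text \<open>Strong induction on the length: a repeated vertex splits a closed walk into two shorter
  closed walks whose gains add up to the original one.\<close>

lemma (in pair_graph) closed_walk_gain:
  assumes cycles: "\<And>p. cycle_traversal G p \<Longrightarrow> [gain D p = 0] (mod m)"
    and "awalk u p u"
  shows "[gain D p = 0] (mod m)"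
  using assms(2)
proof (induction "length p" arbitrary: p u rule: less_induct)
  case less
  \<comment> \<open>The start of a closed walk reappears as its end, so repetitions are only sought
    after dropping it with \<open>tl\<close>.\<close>
  consider "p = []" | "p \<noteq> []" "distinct (tl (pawalk_verts u p))"
    | "\<not> distinct (tl (pawalk_verts u p))" by blast
  then show ?case
  proof cases
    case 1
    then show ?thesis by simp
  next
    case 2
    then have cyc: "cycle p" using less.prems unfolding cycle_def by blast
    then have "2 \<le> length p" unfolding cycle_digraph_conv by blast
    then consider "3 \<le> length p" | "length p = 2" by linarith
    then show ?thesis
    proof cases
      case 1
      then show ?thesis using cycles cyc by (simp add: cycle_traversal_def)
    next
      \<comment> \<open>A cycle of length 2 is not a \<open>cycle_traversal\<close>, but it runs
        back and forth along one edge, so its two gains cancel.\<close>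
      case 2
      then obtain e e' where "p = [e, e']"
        by (auto simp: numeral_2_eq_2 length_Suc_conv)
      then obtain v where "p = [(u, v), (v, u)]"
        using less.prems by (cases e, cases e') (auto simp: awalk_def)
      then show ?thesis
        using gain_Cons[of D "(u, v)" "[(v, u)]"] gain_swap[of D v u] by simp
    qed
  next
    case 3
    \<comment> \<open>Setting the first arc aside ensures that the closed subwalk found in
      \<open>es\<close> is shorter than \<open>p\<close>; in \<open>p\<close> itself it could be all
      of \<open>p\<close>.\<close>
    then obtain e es where p: "p = e # es" by (cases p) auto
    then have es: "awalk (snd e) es u" "\<not> distinct (pawalk_verts (snd e) es)"
      and e: "awalk u [e] (snd e)"
      using 3 less.prems by (auto simp: awalk_Cons_iff awalk_Nil_iff)
    obtain q r s w where decomp: "es = q @ r @ s"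
      "awalk (snd e) q w" "awalk w r w" "awalk w s u" "closed_w r"
      using awalk_cyc_decompE'[OF es] by metis
    then have "r \<noteq> []" by (auto simp: closed_w_def)
    \<comment> \<open>Excising \<open>r\<close> leaves a closed walk, which is shorter because
      \<open>r\<close> is nonempty.\<close>
    have "awalk u ([e] @ q @ s) u"
      using e decomp by (blast intro: awalk_appendI)
    then have "[gain D ([e] @ q @ s) = 0] (mod m)"
      using less.hyps[of "[e] @ q @ s"] p decomp(1) \<open>r \<noteq> []\<close> by simp
    moreover have "[gain D r = 0] (mod m)"
      using less.hyps[of r] decomp p by simp
    ultimately have "[gain D ([e] @ q @ s) + gain D r = 0 + 0] (mod m)"
      by (rule cong_add)
    moreover have "gain D p = gain D ([e] @ q @ s) + gain D r"
      unfolding p decomp(1) gain_Cons[of D e "q @ r @ s"] by (simp add: gain_Cons[of D e "q @ s"])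
    ultimately show ?thesis by simp
  qed
qed

text \<open>The potential at \<open>v\<close> is the gain of an arbitrarily chosen walk from a root
  to \<open>v\<close>; closed walks of gain 0 make the choice irrelevant modulo
  \<open>m\<close>.\<close>

lemma (in pair_graph) balanced_imp_potential:
  assumes conn: "Digraph_Component.connected (with_proj G)"
    and cycles: "\<And>p. cycle_traversal G p \<Longrightarrow> [gain D p = 0] (mod m)"
  shows "\<exists>f. potential m G D f"
proof -
  have sc: "strongly_connected (with_proj G)"
    using conn pair_sym_arcs by (rule symmetric_connected_imp_strongly_connected[rotated])
  \<comment> \<open>Strong connectedness includes that there is at least one vertex, which supplies
    the root.\<close>
  then obtain r where r: "r \<in> pverts G"
    by (auto simp: strongly_connected_def)
  have "\<exists>p. awalk r p v" if "v \<in> pverts G" for v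
    using sc r that by (auto simp: strongly_connected_def reachable_awalk)
  then obtain P where P: "\<And>v. v \<in> pverts G \<Longrightarrow> awalk r (P v) v" by metis
  have "[gain D (P v) = gain D (P u) + gain D [(u, v)]] (mod m)"
    if uv: "(u, v) \<in> parcs G" for u v
  proof -
    \<comment> \<open>Go to \<open>u\<close>, cross the arc and return along the chosen walk to
      \<open>v\<close> reversed. The return is a walk because the arcs are symmetric, and it
      contributes \<open>- gain D (P v)\<close>.\<close>
    have "awalk r (P u) u" "awalk u [(u, v)] v" "awalk v (rev_path (P v)) r"
      using uv P by (auto simp: awalk_Cons_iff awalk_Nil_iff dest: in_arcsD1 in_arcsD2)
    then have "awalk r (P u @ [(u, v)] @ rev_path (P v)) r"
      by (blast intro: awalk_appendI)
    then have "[gain D (P u @ [(u, v)] @ rev_path (P v)) = 0] (mod m)"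
      using closed_walk_gain[OF cycles] by blast
    then have "[gain D (P u) + gain D [(u, v)] - gain D (P v) = 0] (mod m)"
      by (simp only: gain_append gain_rev_path) (simp add: algebra_simps)
    then show ?thesis
      by (simp add: cong_diff_iff_cong_0 cong_sym)
  qed
  then have "potential m G D (\<lambda>v. gain D (P v))" by (simp add: potential_def)
  then show ?thesis by blast
qed

theorem theorem2p10:
  fixes G :: "'a pair_pre_digraph" and D :: "'a rel"
  assumes "pair_graph G"
    and "Digraph_Component.connected (with_proj G)"
    and "mixed_graph G D"
  shows "property_SP G D \<longleftrightarrow> (\<forall>p. cycle_traversal G p \<longrightarrow> in_Phi4 D p)"
proof
  interpret pair_graph G by fact
  assume "property_SP G D"
  then obtain f where f: "potential 6 G D f"
    using SP_imp_potential[OF assms(3)] by blast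
  show "\<forall>p. cycle_traversal G p \<longrightarrow> in_Phi4 D p"
  proof (intro allI impI)
    fix p assume "cycle_traversal G p"
    then obtain u where "awalk u p u"
      by (auto simp: cycle_traversal_def cycle_def)
    then have "[f u = f u + gain D p] (mod 6)"
      by (intro potential_walk[OF f]) (auto simp: awalk_def)
    then show "in_Phi4 D p"
      \<comment> \<open>The walk ends where it starts, so \<open>f u\<close> cancels from both
        sides.\<close>
      unfolding in_Phi4_iff_gain
      using cong_add_lcancel[of "f u" 0 "gain D p" 6] by (simp add: cong_sym_eq)
  qed
next
  interpret pair_graph G by fact
  assume "\<forall>p. cycle_traversal G p \<longrightarrow> in_Phi4 D p"
  then show "property_SP G D"
    using balanced_imp_potential[OF assms(2)] potential_imp_SP[OF assms(1,3)]
    unfolding in_Phi4_iff_gain by blast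
qed

end
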